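(* If $\mathfrak{b}>\omega_1$, then $\nabla A(\omega_1)^\omega$ is not hereditarily normal.
   Context: $\mathfrak{b}$ is the minimal size of an unbounded subset of $\omega^\omega$ under the mod-finite order $\leq^*$. $A(\omega_1)$ is the one-point compactification of the discrete space of size $\omega_1$. For a space $X$, the box product $\square X^\omega$ is $X^\omega$ with base all $\prod_nU_n$, $U_n$ open in $X$; $x\sim y$ iff $\{n:x(n)\ne y(n)\}$ is finite; $\nabla X^\omega$ is the quotient space $\square X^\omega/\sim$. A space is hereditarily normal if every subspace is normal. *)

theory Defs
  imports "HOL-Analysis.Analysis"
begin

unbundle cardinal_syntax

section \<open>The bounding number\<close>

definition le_star :: "(nat \<Rightarrow> nat) \<Rightarrow> (nat \<Rightarrow> nat) \<Rightarrow> bool" (infix "\<le>\<^sup>*" 50)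
  where "f \<le>\<^sup>* g \<longleftrightarrow> finite {n. \<not> f n \<le> g n}"

definition unbounded_family :: "(nat \<Rightarrow> nat) set \<Rightarrow> bool"
  where "unbounded_family F \<longleftrightarrow> \<not> (\<exists>g. \<forall>f\<in>F. f \<le>\<^sup>* g)"

text \<open>Cardinal numbers are represented by cardinal orders, so the minimal size of an unbounded
  family is the cardinal order of an unbounded family of minimal cardinality.  That such a family
  exists, and that the choice does not matter up to \<open>=o\<close>, is shown below.\<close>

definition bounding_number :: "(nat \<Rightarrow> nat) rel"
  where "bounding_number =
    card_of (SOME F. unbounded_family F \<and> (\<forall>G. unbounded_family G \<longrightarrow> |F| \<le>o |G| ))"

lemma unbounded_family_UNIV: "unbounded_family UNIV"
proof -
  have "\<not> (\<lambda>n. Suc (g n)) \<le>\<^sup>* g" for g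
    by (simp add: le_star_def)
  then show ?thesis
    unfolding unbounded_family_def by blast
qed

lemma ex_minimal_unbounded_family:
  "\<exists>F. unbounded_family F \<and> (\<forall>G. unbounded_family G \<longrightarrow> |F| \<le>o |G| )"
proof -
  let ?R = "card_of ` {F. unbounded_family F}"
  have "\<exists>r\<in>?R. \<forall>r'\<in>?R. r \<le>o r'"
    using unbounded_family_UNIV by (intro exists_minim_Card_order) (auto simp: card_of_Card_order)
  then show ?thesis
    by blast
qed

lemma bounding_number_attained:
  "\<exists>F. unbounded_family F \<and> bounding_number = |F|"
  using someI_ex [OF ex_minimal_unbounded_family] unfolding bounding_number_def by blast

lemma bounding_number_le: "unbounded_family G \<Longrightarrow> bounding_number \<le>o |G|"
  using someI_ex [OF ex_minimal_unbounded_family] unfolding bounding_number_def by blast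


section \<open>Box powers and the nabla quotient\<close>

definition box_power :: "'a topology \<Rightarrow> (nat \<Rightarrow> 'a) topology"
  where "box_power X = topology (arbitrary union_of
    (\<lambda>B. \<exists>U. (\<forall>n. openin X (U n)) \<and> B = (\<Pi>\<^sub>E n\<in>UNIV. U n)))"

lemma openin_box_power:
  "openin (box_power X) =
    arbitrary union_of (\<lambda>B. \<exists>U. (\<forall>n. openin X (U n)) \<and> B = (\<Pi>\<^sub>E n\<in>UNIV. U n))"
proof -
  have "\<exists>W. (\<forall>n. openin X (W n)) \<and> S \<inter> T = (\<Pi>\<^sub>E n\<in>UNIV. W n)"
    if ST: "\<exists>U. (\<forall>n. openin X (U n)) \<and> S = (\<Pi>\<^sub>E n\<in>UNIV. U n)"
      "\<exists>V. (\<forall>n. openin X (V n)) \<and> T = (\<Pi>\<^sub>E n\<in>UNIV. V n)" for S T :: "(nat \<Rightarrow> 'a) set"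
  proof -
    obtain U V where "\<forall>n. openin X (U n)" "S = (\<Pi>\<^sub>E n\<in>UNIV. U n)"
      "\<forall>n. openin X (V n)" "T = (\<Pi>\<^sub>E n\<in>UNIV. V n)"
      using ST by blast
    then show ?thesis
      by (intro exI [of _ "\<lambda>n. U n \<inter> V n"]) (simp add: PiE_Int openin_Int)
  qed
  then show ?thesis
    unfolding box_power_def by (intro topology_inverse' istopology_base)
qed

lemma topspace_box_power: "topspace (box_power X) = (\<Pi>\<^sub>E n\<in>UNIV. topspace X)"
proof
  show "topspace (box_power X) \<subseteq> (\<Pi>\<^sub>E n\<in>UNIV. topspace X)"
  proof
    fix x assume "x \<in> topspace (box_power X)"
    then obtain S where S: "openin (box_power X) S" "x \<in> S"
      unfolding topspace_def by blast
    then obtain U where "\<forall>n. openin X (U n)" "x \<in> (\<Pi>\<^sub>E n\<in>UNIV. U n)"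
      unfolding openin_box_power union_of_def by blast
    then show "x \<in> (\<Pi>\<^sub>E n\<in>UNIV. topspace X)"
      using openin_subset [of X] unfolding PiE_UNIV_domain Pi_iff by blast
  qed
  have "openin (box_power X) (\<Pi>\<^sub>E n\<in>UNIV. topspace X)"
    unfolding openin_box_power by (rule arbitrary_union_of_inc) auto
  then show "(\<Pi>\<^sub>E n\<in>UNIV. topspace X) \<subseteq> topspace (box_power X)"
    by (rule openin_subset)
qed

text \<open>The quotient space of a space \<open>X\<close> by an equivalence relation \<open>R\<close> on its underlying set;
  its points are the equivalence classes.\<close>

definition quotient_topology :: "'a topology \<Rightarrow> 'a rel \<Rightarrow> 'a set topology"
  where "quotient_topology X R = topology (\<lambda>W. W \<subseteq> topspace X // R \<and> openin X (\<Union>W))"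

lemma openin_quotient_topology:
  assumes R: "equiv (topspace X) R"
  shows "openin (quotient_topology X R) W \<longleftrightarrow> W \<subseteq> topspace X // R \<and> openin X (\<Union>W)"
proof -
  have "istopology (\<lambda>W. W \<subseteq> topspace X // R \<and> openin X (\<Union>W))"
    unfolding istopology_def
  proof (intro conjI allI impI; (elim conjE)?)
    fix S T
    assume S: "S \<subseteq> topspace X // R" "openin X (\<Union>S)" and T: "T \<subseteq> topspace X // R" "openin X (\<Union>T)"
    show "S \<inter> T \<subseteq> topspace X // R"
      using S by blast
    have "\<Union>(S \<inter> T) = \<Union>S \<inter> \<Union>T"
    proof
      show "\<Union>S \<inter> \<Union>T \<subseteq> \<Union>(S \<inter> T)"
      proof
        fix x assume "x \<in> \<Union>S \<inter> \<Union>T"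
        then obtain A B where AB: "A \<in> S" "B \<in> T" "x \<in> A" "x \<in> B"
          by blast
        then have "A = B"
          using quotient_disj [OF R, of A B] S T by blast
        then show "x \<in> \<Union>(S \<inter> T)"
          using AB by blast
      qed
    qed blast
    then show "openin X (\<Union>(S \<inter> T))"
      using openin_Int [OF S(2) T(2)] by simp
  next
    fix K
    assume K: "\<forall>W\<in>K. W \<subseteq> topspace X // R \<and> openin X (\<Union>W)"
    show "\<Union>K \<subseteq> topspace X // R"
      using K by blast
    have "\<Union>(\<Union>K) = \<Union>(Union ` K)"
      by blast
    moreover have "openin X (\<Union>(Union ` K))"
      using K by (intro openin_Union) auto
    ultimately show "openin X (\<Union>(\<Union>K))"
      by simp
  qed
  then show ?thesis
    unfolding quotient_topology_def by simp
qed

lemma topspace_quotient_topology: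
  assumes R: "equiv (topspace X) R"
  shows "topspace (quotient_topology X R) = topspace X // R"
proof
  show "topspace (quotient_topology X R) \<subseteq> topspace X // R"
    using openin_topspace [of "quotient_topology X R"]
    unfolding openin_quotient_topology [OF R] by blast
  have "openin (quotient_topology X R) (topspace X // R)"
    unfolding openin_quotient_topology [OF R] Union_quotient [OF R] by simp
  then show "topspace X // R \<subseteq> topspace (quotient_topology X R)"
    by (rule openin_subset)
qed

lemma quotient_map_quotient_topology:
  assumes R: "equiv (topspace X) R"
  shows "quotient_map X (quotient_topology X R) (\<lambda>x. R `` {x})"
  unfolding quotient_map_def topspace_quotient_topology [OF R] openin_quotient_topology [OF R]
proof (intro conjI allI impI)
  show "(\<lambda>x. R `` {x}) ` topspace X = topspace X // R"
    by (auto simp: quotient_def)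
  fix W assume W: "W \<subseteq> topspace X // R"
  have "{x \<in> topspace X. R `` {x} \<in> W} = \<Union>W"
  proof (intro set_eqI iffI)
    fix x assume "x \<in> {x \<in> topspace X. R `` {x} \<in> W}"
    then show "x \<in> \<Union>W"
      using equiv_class_self [OF R] by blast
  next
    fix x assume "x \<in> \<Union>W"
    then obtain A where A: "A \<in> W" "x \<in> A"
      by blast
    then obtain y where y: "y \<in> topspace X" "A = R `` {y}"
      using W by (blast elim: quotientE)
    then have "(y, x) \<in> R"
      using A by blast
    then have "x \<in> topspace X" "R `` {x} = A"
      using y equiv_class_eq_iff [OF R, of y x] by simp_all
    then show "x \<in> {x \<in> topspace X. R `` {x} \<in> W}"
      using A by blast
  qed
  then show "openin X {x \<in> topspace X. R `` {x} \<in> W} \<longleftrightarrow> W \<subseteq> topspace X // R \<and> openin X (\<Union>W)"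
    using W by simp
qed

definition eq_mod_finite :: "'a topology \<Rightarrow> (nat \<Rightarrow> 'a) rel"
  where "eq_mod_finite X = {(x, y). x \<in> topspace (box_power X) \<and> y \<in> topspace (box_power X) \<and>
    finite {n. x n \<noteq> y n}}"

lemma equiv_eq_mod_finite: "equiv (topspace (box_power X)) (eq_mod_finite X)"
proof (rule equivI)
  show "eq_mod_finite X \<subseteq> topspace (box_power X) \<times> topspace (box_power X)"
    by (auto simp: eq_mod_finite_def)
  show "refl_on (topspace (box_power X)) (eq_mod_finite X)"
    by (auto simp: refl_on_def eq_mod_finite_def)
  show "sym (eq_mod_finite X)"
  proof (rule symI)
    fix x y assume "(x, y) \<in> eq_mod_finite X"
    moreover have "{n. y n \<noteq> x n} = {n. x n \<noteq> y n}"
      by metis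
    ultimately show "(y, x) \<in> eq_mod_finite X"
      by (simp add: eq_mod_finite_def)
  qed
  show "trans (eq_mod_finite X)"
  proof (rule transI)
    fix x y z assume xyz: "(x, y) \<in> eq_mod_finite X" "(y, z) \<in> eq_mod_finite X"
    have "{n. x n \<noteq> z n} \<subseteq> {n. x n \<noteq> y n} \<union> {n. y n \<noteq> z n}"
      by auto
    then show "(x, z) \<in> eq_mod_finite X"
      using xyz finite_subset [of "{n. x n \<noteq> z n}"] by (simp add: eq_mod_finite_def)
  qed
qed

definition nabla_power :: "'a topology \<Rightarrow> (nat \<Rightarrow> 'a) set topology"
  where "nabla_power X = quotient_topology (box_power X) (eq_mod_finite X)"

end

theory Submission
  imports Defs "HOL-Library.Countable_Set_Type"
begin

text \<open>This is the pattern of Katetov's theorem on hereditarily normal products, with the even and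
  the odd coordinates as the two factors. Let \<open>P\<close> and \<open>Q\<close> be the sets of those classes that
  differ from \<open>\<infinity>\<close> at infinitely many even, respectively odd, places. Both are open, so \<open>P - Q\<close> and
  \<open>Q - P\<close> are separated. Suppose that disjoint open sets \<open>U\<close> and \<open>V\<close> contain them. For each point
  \<open>a\<close> of the discrete space, \<open>P - Q\<close> contains the class of the sequence that is \<open>a\<close> at even places
  and \<open>\<infinity>\<close> at odd places; fixing a countable set \<open>e ` \<nat>\<close> of points, one gets a function \<open>g a\<close> such
  that \<open>U\<close> contains the class of the sequence \<open>(a, e \<circ> f)\<close> whenever \<open>f\<close> dominates \<open>g a\<close>. As there
  are fewer than \<open>\<bb>\<close> many \<open>a\<close>, one \<open>f\<close> dominates all the \<open>g a\<close>. But \<open>V\<close> contains \<open>(\<infinity>, e \<circ> f)\<close>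
  and hence \<open>(a, e \<circ> f)\<close> for all but countably many \<open>a\<close>.\<close>

lemma bounded_if_less_bounding_number:
  assumes "|F| <o bounding_number"
  shows "\<exists>g. \<forall>f\<in>F. f \<le>\<^sup>* g"
  using bounding_number_le [of F] not_ordLess_ordLeq [OF assms]
  by (auto simp: unbounded_family_def)

text \<open>\<open>cardSuc natLeq\<close> is \<omega>_1, which lies strictly above the cardinal that
  bounds all countable sets.\<close>

lemma uncountable_if_cardSuc_natLeq:
  assumes "|D| =o cardSuc natLeq"
  shows "uncountable D"
  unfolding countable_card_le_natLeq
  by (rule not_ordLess_ordLeq [OF ordLess_ordIso_trans
        [OF cardSuc_greater [OF natLeq_Card_order] ordIso_symmetric [OF assms]]])

text \<open>\<open>None\<close> is the point \<infinity>; its neighbourhoods have compact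
  complements, and compact sets in a discrete space are finite.\<close>

lemma openin_Alexandroff_compactification_discrete_None:
  assumes "openin (Alexandroff_compactification (discrete_topology D)) V" and "None \<in> V"
  obtains C where "finite C" and "V = insert None (Some ` (D - C))"
  using assms by (auto simp: openin_Alexandroff_compactification compactin_discrete_topology)

lemma openin_box_power_iff:
  "openin (box_power X) W \<longleftrightarrow>
    (\<forall>x\<in>W. \<exists>U. (\<forall>n. openin X (U n) \<and> x n \<in> U n) \<and> (\<forall>y. (\<forall>n. y n \<in> U n) \<longrightarrow> y \<in> W))"
  (is "?L \<longleftrightarrow> ?R")
proof
  assume ?L
  then obtain \<U> where \<U>: "\<Union>\<U> = W"
    "\<And>B. B \<in> \<U> \<Longrightarrow> \<exists>U. (\<forall>n. openin X (U n)) \<and> B = (\<Pi>\<^sub>E n\<in>UNIV. U n)"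
    unfolding openin_box_power union_of_def by blast
  show ?R
  proof
    fix x assume "x \<in> W"
    then obtain B where "B \<in> \<U>" "x \<in> B"
      using \<U> by blast
    moreover from this obtain U where "\<forall>n. openin X (U n)" "B = (\<Pi>\<^sub>E n\<in>UNIV. U n)"
      using \<U> by blast
    ultimately show "\<exists>U. (\<forall>n. openin X (U n) \<and> x n \<in> U n) \<and> (\<forall>y. (\<forall>n. y n \<in> U n) \<longrightarrow> y \<in> W)"
      using \<U>(1) by (intro exI [of _ U]) (auto simp: PiE_UNIV_domain Pi_iff)
  qed
next
  assume R: ?R
  show ?L
  proof (subst openin_subopen, intro ballI)
    fix x assume "x \<in> W"
    then obtain U where U: "\<And>n. openin X (U n)" "\<And>n. x n \<in> U n"
      and sub: "\<And>y. (\<And>n. y n \<in> U n) \<Longrightarrow> y \<in> W"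
      using R by metis
    have "openin (box_power X) (\<Pi>\<^sub>E n\<in>UNIV. U n)"
      unfolding openin_box_power using U by (intro arbitrary_union_of_inc) blast
    with U sub show "\<exists>T. openin (box_power X) T \<and> x \<in> T \<and> T \<subseteq> W"
      by (intro exI [of _ "\<Pi>\<^sub>E n\<in>UNIV. U n"]) (simp add: PiE_UNIV_domain Pi_iff subset_iff)
  qed
qed

lemma in_topspace_box_power: "x \<in> topspace (box_power X) \<longleftrightarrow> (\<forall>n. x n \<in> topspace X)"
  by (simp add: topspace_box_power PiE_UNIV_domain Pi_iff)

lemma openin_nabla_power:
  "openin (nabla_power X) W \<longleftrightarrow>
    W \<subseteq> topspace (box_power X) // eq_mod_finite X \<and> openin (box_power X) (\<Union>W)"
  unfolding nabla_power_def by (rule openin_quotient_topology [OF equiv_eq_mod_finite])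

abbreviation nabla_class :: "'a topology \<Rightarrow> (nat \<Rightarrow> 'a) \<Rightarrow> (nat \<Rightarrow> 'a) set"
  where "nabla_class X x \<equiv> eq_mod_finite X `` {x}"

text \<open>Finite changes do not affect a class, so \<open>y\<close> may leave the box at finitely
  many coordinates. This is what lets domination modulo finite sets decide membership in
  \<open>W\<close>.\<close>

lemma openin_nabla_power_nbhd:
  assumes W: "openin (nabla_power X) W" and x: "x \<in> topspace (box_power X)" "nabla_class X x \<in> W"
  obtains U where "\<And>n. openin X (U n)" and "\<And>n. x n \<in> U n"
    and "\<And>y. \<lbrakk>y \<in> topspace (box_power X); finite {n. y n \<notin> U n}\<rbrakk> \<Longrightarrow> nabla_class X y \<in> W"
proof -
  have W': "W \<subseteq> topspace (box_power X) // eq_mod_finite X" "openin (box_power X) (\<Union>W)"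
    using W by (simp_all add: openin_nabla_power)
  have "x \<in> \<Union>W"
    using x equiv_class_self [OF equiv_eq_mod_finite] by blast
  then obtain U where U: "\<And>n. openin X (U n)" "\<And>n. x n \<in> U n"
    and sub: "\<And>y. (\<And>n. y n \<in> U n) \<Longrightarrow> y \<in> \<Union>W"
    using W'(2) unfolding openin_box_power_iff by metis
  have "nabla_class X y \<in> W" if y: "y \<in> topspace (box_power X)" "finite {n. y n \<notin> U n}" for y
  proof -
    \<comment> \<open>Repairing \<open>y\<close> by values of \<open>x\<close> at its finitely many
      bad coordinates moves it into the box within its class.\<close>
    define y' where "y' n = (if y n \<in> U n then y n else x n)" for n
    have "y' \<in> \<Union>W"
      using U by (intro sub) (simp add: y'_def)
    then obtain z where A: "nabla_class X z \<in> W" "y' \<in> nabla_class X z"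
      using W'(1) by (blast elim: quotientE)
    have "finite {n. y n \<noteq> y' n}"
      by (rule finite_subset [OF _ y(2)]) (auto simp: y'_def)
    then have "(y, y') \<in> eq_mod_finite X"
      using x y by (auto simp: eq_mod_finite_def in_topspace_box_power y'_def)
    then have "nabla_class X y = nabla_class X y'"
      by (rule equiv_class_eq [OF equiv_eq_mod_finite])
    also have "\<dots> = nabla_class X z"
      using A(2) by (intro equiv_class_eq [OF equiv_eq_mod_finite, symmetric]) simp
    finally show ?thesis
      using A(1) by simp
  qed
  with U show thesis
    by (rule that)
qed

text \<open>Asking for infinitely many places makes the condition independent of the
  representative.\<close>

definition nabla_support :: "'a topology \<Rightarrow> 'a \<Rightarrow> nat set \<Rightarrow> (nat \<Rightarrow> 'a) set set"
  where "nabla_support X p J =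
    nabla_class X ` {x \<in> topspace (box_power X). infinite {n \<in> J. x n \<noteq> p}}"

lemma infinite_support_cong:
  assumes "(x, y) \<in> eq_mod_finite X" and "infinite {n \<in> J. x n \<noteq> p}"
  shows "infinite {n \<in> J. y n \<noteq> p}"
proof
  assume "finite {n \<in> J. y n \<noteq> p}"
  then have "finite ({n. x n \<noteq> y n} \<union> {n \<in> J. y n \<noteq> p})"
    using assms by (simp add: eq_mod_finite_def)
  moreover have "{n \<in> J. x n \<noteq> p} \<subseteq> {n. x n \<noteq> y n} \<union> {n \<in> J. y n \<noteq> p}"
    by auto
  ultimately show False
    using assms(2) finite_subset by blast
qed

lemma Union_nabla_support:
  "\<Union>(nabla_support X p J) = {x \<in> topspace (box_power X). infinite {n \<in> J. x n \<noteq> p}}"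
proof (intro set_eqI iffI)
  fix y assume "y \<in> \<Union>(nabla_support X p J)"
  then obtain x where "infinite {n \<in> J. x n \<noteq> p}" "(x, y) \<in> eq_mod_finite X"
    unfolding nabla_support_def by blast
  then show "y \<in> {x \<in> topspace (box_power X). infinite {n \<in> J. x n \<noteq> p}}"
    using infinite_support_cong by (fastforce simp: eq_mod_finite_def)
next
  fix x assume "x \<in> {x \<in> topspace (box_power X). infinite {n \<in> J. x n \<noteq> p}}"
  then show "x \<in> \<Union>(nabla_support X p J)"
    using equiv_class_self [OF equiv_eq_mod_finite] unfolding nabla_support_def by fastforce
qed

lemma nabla_class_in_support_iff:
  assumes "x \<in> topspace (box_power X)"
  shows "nabla_class X x \<in> nabla_support X p J \<longleftrightarrow> infinite {n \<in> J. x n \<noteq> p}"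
proof
  assume "nabla_class X x \<in> nabla_support X p J"
  then have "x \<in> \<Union>(nabla_support X p J)"
    using equiv_class_self [OF equiv_eq_mod_finite assms] by blast
  then show "infinite {n \<in> J. x n \<noteq> p}"
    by (simp add: Union_nabla_support)
qed (use assms in \<open>auto simp: nabla_support_def\<close>)

lemma openin_nabla_support:
  assumes "openin X (topspace X - {p})"
  shows "openin (nabla_power X) (nabla_support X p J)"
  unfolding openin_nabla_power Union_nabla_support openin_box_power_iff
proof (intro conjI ballI)
  show "nabla_support X p J \<subseteq> topspace (box_power X) // eq_mod_finite X"
    by (auto simp: nabla_support_def quotientI)
next
  fix x assume x: "x \<in> {x \<in> topspace (box_power X). infinite {n \<in> J. x n \<noteq> p}}"
  \<comment> \<open>This box avoids \<open>p\<close> wherever \<open>x\<close> does, so the support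
    of each of its members contains that of \<open>x\<close>.\<close>
  define U where "U n = (if x n = p then topspace X else topspace X - {p})" for n
  have "(\<forall>n. openin X (U n) \<and> x n \<in> U n)"
    using x assms by (auto simp: U_def in_topspace_box_power)
  moreover have "y \<in> {x \<in> topspace (box_power X). infinite {n \<in> J. x n \<noteq> p}}"
    if y: "\<forall>n. y n \<in> U n" for y
  proof -
    have "y n \<in> topspace X \<and> (x n \<noteq> p \<longrightarrow> y n \<noteq> p)" for n
      using y [rule_format, of n] by (auto simp: U_def split: if_splits)
    then have "{n \<in> J. x n \<noteq> p} \<subseteq> {n \<in> J. y n \<noteq> p}" "y \<in> topspace (box_power X)"
      by (auto simp: in_topspace_box_power)
    then show ?thesis
      using x finite_subset by blast
  qed
  ultimately show "\<exists>U. (\<forall>n. openin X (U n) \<and> x n \<in> U n) \<and>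
      (\<forall>y. (\<forall>n. y n \<in> U n) \<longrightarrow> y \<in> {x \<in> topspace (box_power X). infinite {n \<in> J. x n \<noteq> p}})"
    by blast
qed

lemma infinite_even: "infinite {n::nat. even n}"
  unfolding infinite_nat_iff_unbounded_le
  by (metis dvd_triv_left le_add1 mem_Collect_eq mult_2)

lemma infinite_odd: "infinite {n::nat. odd n}"
  unfolding infinite_nat_iff_unbounded_le
  by (metis even_Suc le_SucI mem_Collect_eq order_refl)

theorem theorem27:
  fixes D :: "'a set"
  assumes "|D| =o cardSuc natLeq"
    and "cardSuc natLeq <o bounding_number"
  shows "\<not> hereditarily normal_space (nabla_power (Alexandroff_compactification (discrete_topology D)))"
proof
  define X where "X = Alexandroff_compactification (discrete_topology D)"
  assume "hereditarily normal_space (nabla_power (Alexandroff_compactification (discrete_topology D)))"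
  then have normal: "hereditarily normal_space (nabla_power X)"
    by (simp add: X_def)
  have top: "topspace X = insert None (Some ` D)"
    by (simp add: X_def)
  have unc: "uncountable D"
    using assms(1) by (rule uncountable_if_cardSuc_natLeq)
  then obtain e :: "nat \<Rightarrow> 'a" where e: "inj e" "range e \<subseteq> D"
    using infinite_countable_subset uncountable_infinite by metis
  then have eD: "e i \<in> D" for i
    by blast

  define P where "P = nabla_support X None {n. even n}"
  define Q where "Q = nabla_support X None {n. odd n}"
  have "topspace X - {None} = Some ` D"
    by (auto simp: top)
  then have "openin X (topspace X - {None})"
    by (simp add: X_def)
  then have "separatedin (nabla_power X) (P - Q) (Q - P)"
    unfolding P_def Q_def by (intro separatedin_openin_diff openin_nabla_support)
  \<comment> \<open>Hereditary normality amounts to separating any two separated sets by disjoint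
    open sets of the whole space.\<close>
  then obtain U V where UV: "openin (nabla_power X) U" "openin (nabla_power X) V"
      "P - Q \<subseteq> U" "Q - P \<subseteq> V" "disjnt U V"
    using normal unfolding hereditarily_normal_separation by meson

  \<comment> \<open>The sequence \<open>(a, e \<circ> f)\<close>: only the values of
    \<open>f\<close> at odd places matter. Its class lies in both \<open>P\<close> and
    \<open>Q\<close>.\<close>
  define w where "w a f n = Some (if even n then a else e (f n))" for a n and f :: "nat \<Rightarrow> nat"
  have w: "w a f \<in> topspace (box_power X)" if "a \<in> D" for a f
    using that eD by (auto simp: w_def in_topspace_box_power top)

  have "\<exists>g. \<forall>f. g \<le>\<^sup>* f \<longrightarrow> nabla_class X (w a f) \<in> U" if a: "a \<in> D" for a
  proof -
    define h where "h n = (if even n then Some a else None)" for n :: nat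
    have h: "h \<in> topspace (box_power X)"
      using a by (simp add: h_def in_topspace_box_power top)
    then have "nabla_class X h \<in> P - Q"
      by (simp add: P_def Q_def nabla_class_in_support_iff h_def infinite_even cong: conj_cong)
    then have "nabla_class X h \<in> U"
      using UV by blast
    then obtain B where B: "\<And>n. openin X (B n)" "\<And>n. h n \<in> B n"
      and sub: "\<And>y. \<lbrakk>y \<in> topspace (box_power X); finite {n. y n \<notin> B n}\<rbrakk> \<Longrightarrow> nabla_class X y \<in> U"
      using openin_nabla_power_nbhd [OF UV(1) h] by metis
    \<comment> \<open>At odd \<open>n\<close> the set \<open>B n\<close> is a neighbourhood of
      \<infinity>; by injectivity of \<open>e\<close> it misses only finitely many
      \<open>e i\<close>. These thresholds form \<open>g\<close>.\<close>
    have "\<exists>k. \<forall>i\<ge>k. Some (e i) \<in> B n" if "odd n" for n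
    proof -
      have "None \<in> B n"
        using B(2) [of n] that by (simp add: h_def)
      then obtain C where C: "finite C" "B n = insert None (Some ` (D - C))"
        using B(1) openin_Alexandroff_compactification_discrete_None unfolding X_def by metis
      have "finite (e -` C)"
        using C e by (simp add: finite_vimageI)
      then obtain k where "\<forall>i\<in>e -` C. i < k"
        using finite_nat_set_iff_bounded by blast
      then have "\<forall>i\<ge>k. Some (e i) \<in> B n"
        using eD not_less unfolding C(2) by (metis DiffI imageI insertI2 vimageI)
      then show ?thesis ..
    qed
    then obtain g where g: "\<And>n i. \<lbrakk>odd n; g n \<le> i\<rbrakk> \<Longrightarrow> Some (e i) \<in> B n"
      by metis
    have "nabla_class X (w a f) \<in> U" if f: "g \<le>\<^sup>* f" for f
    proof (rule sub [OF w [OF a]])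
      \<comment> \<open>At even \<open>n\<close> the sequence agrees with \<open>h\<close>; at odd
        \<open>n\<close> the index \<open>f n\<close> is past the threshold.\<close>
      have "w a f n \<in> B n" if "g n \<le> f n" for n
        using B(2) [of n] g [of n "f n"] that by (auto simp: w_def h_def split: if_splits)
      then have "{n. w a f n \<notin> B n} \<subseteq> {n. \<not> g n \<le> f n}"
        by blast
      then show "finite {n. w a f n \<notin> B n}"
        using f unfolding le_star_def by (rule finite_subset)
    qed
    then show ?thesis
      by blast
  qed
  then obtain g where g: "\<And>a f. \<lbrakk>a \<in> D; g a \<le>\<^sup>* f\<rbrakk> \<Longrightarrow> nabla_class X (w a f) \<in> U"
    by metis
  have "|g ` D| <o bounding_number"
    by (rule ordLeq_ordLess_trans [OF card_of_image ordIso_ordLess_trans [OF assms]])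
  then obtain f where "\<forall>k\<in>g ` D. k \<le>\<^sup>* f"
    using bounded_if_less_bounding_number by blast
  then have wU: "nabla_class X (w a f) \<in> U" if "a \<in> D" for a
    using g that by blast

  \<comment> \<open>With \<open>f\<close> now fixed, \<open>y\<close> is \<open>w a f\<close> with
    \<infinity> at the even places, and so does not depend on \<open>a\<close>.\<close>
  define y where "y n = (if even n then None else Some (e (f n)))" for n
  have y: "y \<in> topspace (box_power X)"
    using eD by (simp add: y_def in_topspace_box_power top)
  then have "nabla_class X y \<in> Q - P"
    by (simp add: P_def Q_def nabla_class_in_support_iff y_def infinite_odd cong: conj_cong)
  then have "nabla_class X y \<in> V"
    using UV by blast
  then obtain B where B: "\<And>n. openin X (B n)" "\<And>n. y n \<in> B n"
    and sub: "\<And>z. \<lbrakk>z \<in> topspace (box_power X); finite {n. z n \<notin> B n}\<rbrakk> \<Longrightarrow> nabla_class X z \<in> V"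
    using openin_nabla_power_nbhd [OF UV(2) y] by metis
  have "\<exists>C. finite C \<and> (\<forall>a\<in>D - C. Some a \<in> B n)" if "even n" for n
  proof -
    have "None \<in> B n"
      using B(2) [of n] that by (simp add: y_def)
    then obtain C where "finite C" "B n = insert None (Some ` (D - C))"
      using B(1) openin_Alexandroff_compactification_discrete_None unfolding X_def by metis
    then show ?thesis
      by blast
  qed
  then obtain C where C: "\<And>n. even n \<Longrightarrow> finite (C n)"
      "\<And>n a. \<lbrakk>even n; a \<in> D - C n\<rbrakk> \<Longrightarrow> Some a \<in> B n"
    by metis
  \<comment> \<open>One \<open>a\<close> must avoid the exceptional sets \<open>C n\<close> of all
    even \<open>n\<close> at once; their union is countable and \<open>D\<close> is not.\<close>
  have "countable (\<Union>n\<in>{n. even n}. C n)"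
    using C(1) by (intro countable_UN) (auto intro: countable_finite)
  then have "\<not> D \<subseteq> (\<Union>n\<in>{n. even n}. C n)"
    using unc countable_subset by metis
  then obtain a where a: "a \<in> D" "\<And>n. even n \<Longrightarrow> a \<notin> C n"
    by blast
  \<comment> \<open>Even coordinates avoid \<open>C n\<close>, odd ones agree with \<open>y\<close>.
    So the class of \<open>w a f\<close> lies in \<open>V\<close> as well as in
    \<open>U\<close>.\<close>
  have "w a f n \<in> B n" for n
    using a C(2) [of n a] B(2) [of n] by (auto simp: w_def y_def split: if_splits)
  then have "nabla_class X (w a f) \<in> V"
    using w a(1) by (intro sub) simp_all
  with wU [OF a(1)] UV(5) show False
    by (auto simp: disjnt_iff)
qed

end
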